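(* For any positive integer $r$, $$\sum_{n=0}^{\infty}\sum_{\lambda\in\mathcal{P}(n)}\bigl(\ell(\lambda)-\mathrm{maex}(\lambda; r)+\Omega_{r}(\lambda)\bigr)q^{n}=\frac{(q^{r+1};q^{r+1})_{\infty}}{(q;q)_{\infty}}+\frac{1}{(q;q)_{\infty}}\sum_{n=1}^{\infty}\frac{q^n(q^{r+1};q^{r+1})_{n}}{1-q^n}.$$
   Context: A partition $\lambda$ of a positive integer $n$ is a weakly decreasing sequence of positive integers $\lambda=(\lambda_1,\lambda_2,\dots)$ (its parts) with sum $n$; the empty partition is the only partition of $0$. $\mathcal{P}(n)$ is the set of partitions of the non-negative integer $n$. $\ell(\lambda)$ denotes the largest part of $\lambda$ (with $\ell(\emptyset)=0$). For a positive integer $r$, $\mathcal{P}_r^0(n)$ is the set of partitions of $n$ in which the gap (difference) between any two successive parts is at most $r$ and the smallest part is at most $r$ (the empty partition belongs to $\mathcal{P}_r^0(0)$, the conditions being vacuous), and $\mathcal{P}_r^+(n)=\mathcal{P}(n)\setminus\mathcal{P}_r^0(n)$. The $r$-chain maximal excludant $\mathrm{maex}(\lambda;r)$ of a partition $\lambda$ is the largest positive integer $k$ less than the largest part of $\lambda$ such that $k,k-1,\dots,k-r+1$ are all positive integers and none of them occurs as a part of $\lambda$; if there is no such $k$, then $\mathrm{maex}(\lambda;r)=0$. The weight $\Omega_r$ is defined for $\lambda\in\mathcal{P}(n)$ by $\Omega_r(\lambda)=1$ if $\lambda\in\mathcal{P}_r^0(n)$ and $\Omega_r(\lambda)=r$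 if $\lambda\in\mathcal{P}_r^+(n)$. $q$-series notation: $(a;q)_0=1$, $(a;q)_n=\prod_{i=0}^{n-1}(1-aq^i)$ for $n\ge 1$, $(a;q)_\infty=\prod_{i=0}^{\infty}(1-aq^i)$; here $q\in\mathbb{C}$ with $|q|<1$ (equivalently, the identity is one of formal power series in $q$). *)

theory Defs
  imports "HOL-Analysis.Analysis"
begin

section \<open>Partitions\<close>

definition partitions :: "nat \<Rightarrow> nat list set" where
  "partitions n = {xs. sorted_wrt (\<ge>) xs \<and> (\<forall>x\<in>set xs. 0 < x) \<and> sum_list xs = n}"

definition largest_part :: "nat list \<Rightarrow> nat" where
  "largest_part xs = (if xs = [] then 0 else Max (set xs))"

text \<open>Since the parts are weakly decreasing, the subtraction below is never truncated and
  \<open>last xs\<close> is the smallest part.\<close>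

definition partitions_0 :: "nat \<Rightarrow> nat \<Rightarrow> nat list set" where
  "partitions_0 r n = {xs \<in> partitions n.
     (\<forall>i. Suc i < length xs \<longrightarrow> xs ! i - xs ! Suc i \<le> r) \<and> (xs \<noteq> [] \<longrightarrow> last xs \<le> r)}"

definition partitions_plus :: "nat \<Rightarrow> nat \<Rightarrow> nat list set" where
  "partitions_plus r n = partitions n - partitions_0 r n"

definition chain_excludants :: "nat list \<Rightarrow> nat \<Rightarrow> nat set" where
  "chain_excludants xs r =
     {k. 0 < k \<and> k < largest_part xs \<and> (\<forall>i<r. i < k \<and> k - i \<notin> set xs)}"

definition maex :: "nat list \<Rightarrow> nat \<Rightarrow> nat" where
  "maex xs r = (if chain_excludants xs r = {} then 0 else Max (chain_excludants xs r))"

text \<open>A partition \<open>xs\<close> is a partition of \<open>sum_list xs\<close> only, so the size need not be an argument;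
  on partitions, the second case is exactly membership in \<open>partitions_plus r (sum_list xs)\<close>.\<close>

definition Omega :: "nat \<Rightarrow> nat list \<Rightarrow> nat" where
  "Omega r xs = (if xs \<in> partitions_0 r (sum_list xs) then 1 else r)"

lemma Omega_partitions_0: "xs \<in> partitions_0 r n \<Longrightarrow> Omega r xs = 1"
  by (auto simp: Omega_def partitions_0_def partitions_def)

lemma Omega_partitions_plus: "xs \<in> partitions_plus r n \<Longrightarrow> Omega r xs = r"
  by (auto simp: Omega_def partitions_plus_def partitions_def)

lemma finite_partitions: "finite (partitions n)"
proof (rule finite_subset)
  have len: "length xs \<le> sum_list xs" if "\<forall>x\<in>set xs. 0 < x" for xs :: "nat list"
    using that by (induction xs) auto
  show "partitions n \<subseteq> {xs. set xs \<subseteq> {..n} \<and> length xs \<le> n}"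
    using len by (auto simp: partitions_def intro: member_le_sum_list)
  show "finite {xs :: nat list. set xs \<subseteq> {..n} \<and> length xs \<le> n}"
    by (rule finite_lists_length_le) simp
qed

lemma finite_chain_excludants: "finite (chain_excludants xs r)"
  by (rule finite_subset[of _ "{..<largest_part xs}"]) (auto simp: chain_excludants_def)

section \<open>q-Pochhammer symbols\<close>

definition qpoch :: "complex \<Rightarrow> complex \<Rightarrow> nat \<Rightarrow> complex" where
  "qpoch a q n = (\<Prod>i<n. 1 - a * q ^ i)"

definition qpoch_inf :: "complex \<Rightarrow> complex \<Rightarrow> complex" where
  "qpoch_inf a q = (\<Prod>i. 1 - a * q ^ i)"

lemma convergent_prod_qpoch:
  assumes "norm q < 1"
  shows "convergent_prod (\<lambda>i. 1 - a * q ^ i :: complex)"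
proof -
  have "summable (\<lambda>i. norm (- (a * q ^ i)))"
    using assms by (simp add: norm_mult norm_power summable_mult summable_geometric)
  hence "abs_convergent_prod (\<lambda>i. 1 + (- (a * q ^ i)))"
    by (simp add: abs_convergent_prod_conv_summable)
  thus ?thesis
    using abs_convergent_prod_imp_convergent_prod by force
qed

lemma qpoch_tendsto_qpoch_inf:
  assumes "norm q < 1"
  shows "qpoch a q \<longlonglongrightarrow> qpoch_inf a q"
proof -
  have "(\<lambda>n. \<Prod>i\<le>n. 1 - a * q ^ i) \<longlonglongrightarrow> qpoch_inf a q"
    unfolding qpoch_inf_def by (rule convergent_prod_LIMSEQ[OF convergent_prod_qpoch[OF assms]])
  hence "(\<lambda>n. qpoch a q (Suc n)) \<longlonglongrightarrow> qpoch_inf a q"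
    by (simp add: qpoch_def lessThan_Suc_atMost)
  thus ?thesis
    by (rule LIMSEQ_imp_Suc)
qed

text \<open>The series on the right-hand side of the identity, shifted to start at index 0, converges.\<close>

lemma summable_rhs:
  fixes q :: complex
  assumes q: "norm q < 1"
  shows "summable (\<lambda>n. q ^ Suc n * qpoch (q ^ Suc r) (q ^ Suc r) (Suc n) / (1 - q ^ Suc n))"
proof -
  have "norm (q ^ Suc r) < 1"
    using q power_decreasing[of 1 "Suc r" "norm q", OF _ norm_ge_zero less_imp_le[OF q]]
    unfolding norm_power power_one_right by linarith
  hence "Bseq (qpoch (q ^ Suc r) (q ^ Suc r))"
    by (intro convergent_imp_Bseq convergentI[OF qpoch_tendsto_qpoch_inf])
  then obtain K where K: "K > 0" "\<And>n. norm (qpoch (q ^ Suc r) (q ^ Suc r) n) \<le> K"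
    by (auto elim: BseqE)
  have "norm (q ^ Suc n * qpoch (q ^ Suc r) (q ^ Suc r) (Suc n) / (1 - q ^ Suc n))
          \<le> K / (1 - norm q) * norm q ^ Suc n" for n
  proof -
    have "norm (q ^ Suc n) \<le> norm q"
      using power_decreasing[of 1 "Suc n" "norm q", OF _ norm_ge_zero less_imp_le[OF q]]
      unfolding norm_power power_one_right by linarith
    hence D: "1 - norm q \<le> norm (1 - q ^ Suc n)"
      using norm_triangle_ineq2[of 1 "q ^ Suc n"] unfolding norm_one by linarith
    have "norm q ^ Suc n * norm (qpoch (q ^ Suc r) (q ^ Suc r) (Suc n)) / norm (1 - q ^ Suc n)
             \<le> norm q ^ Suc n * K / (1 - norm q)"
    proof (rule frac_le)
      show "0 \<le> norm q ^ Suc n * K" using K(1) by simp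
      show "norm q ^ Suc n * norm (qpoch (q ^ Suc r) (q ^ Suc r) (Suc n)) \<le> norm q ^ Suc n * K"
        by (rule mult_left_mono[OF K(2)]) simp
      show "0 < 1 - norm q" using q by simp
    qed (rule D)
    thus ?thesis
      unfolding norm_divide norm_mult norm_power by (simp del: power_Suc add: mult.commute)
  qed
  moreover have "summable (\<lambda>n. K / (1 - norm q) * norm q ^ Suc n)"
  proof (rule summable_mult)
    show "summable (\<lambda>n. norm q ^ Suc n)"
      using q by (subst summable_Suc_iff) (simp add: summable_geometric)
  qed
  ultimately show ?thesis
    by (rule summable_comparison_test'[where N = 0, rotated])
qed

end

theory Submission
  imports Defs
begin

text \<open>
  Arrange the columns of the Ferrers diagram of a partition by height: let \<open>m\<^sub>i\<close> be the number of
  columns of height \<open>i\<close>, i.e. the \<open>i\<close>-th part minus the next one. A partition has no gap above \<open>r\<close>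
  iff all \<open>m\<^sub>i \<le> r\<close>, and then \<open>maex = 0\<close> and the weight \<open>largest_part - maex + Omega\<close> equals
  \<open>1 + (m\<^sub>1 + m\<^sub>2 + \<dots>)\<close>. Otherwise, if \<open>i\<close> is minimal with \<open>m\<^sub>i > r\<close>, the largest chain ends just below the
  \<open>i\<close>-th part and the weight is \<open>1 + (m\<^sub>1 + \<dots> + m\<^sub>i\<^sub>-\<^sub>1) + r\<close>. In both cases the weight is \<open>1\<close>
  plus the sum of \<open>min m\<^sub>i r\<close> over those \<open>i\<close> with all earlier multiplicities at most \<open>r\<close>.

  This formula is local, so it can be built up one height at a time. Partitions with at most
  \<open>N + 1\<close> parts are obtained bijectively from pairs of a number \<open>m\<close> and a partition with at most \<open>N\<close>
  parts, by adding \<open>m\<close> columns of height \<open>N + 1\<close>; the size grows by \<open>(N + 1) * m\<close>, and the weight grows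
  by \<open>min m r\<close> if there was no chain before and does not change otherwise (\<open>weight_add_columns\<close>).
  This yields a recurrence in \<open>N\<close> for the weighted generating function, whose solution
  (\<open>gf_weight\<close>) is the right-hand side with the infinite products and the series truncated at \<open>N\<close>.

  It remains to let \<open>N\<close> tend to infinity. Applied to \<open>norm q\<close>, the closed form bounds all finite
  sums of absolute values, so the sum over all partitions converges absolutely
  (\<open>summable_weight\<close>) and may be computed either along the number of parts, giving the right-hand side,
  or along the size, giving the power series on the left.
\<close>

section \<open>Chains of missing parts\<close>

definition partitions_upto :: "nat \<Rightarrow> nat list set" where
  "partitions_upto N = {xs. sorted_wrt (\<ge>) xs \<and> (\<forall>x\<in>set xs. 0 < x) \<and> length xs \<le> N}"

lemma partitions_upto_0: "partitions_upto 0 = {[]}"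
  by (auto simp: partitions_upto_def)

lemma largest_part_Nil [simp]: "largest_part [] = 0"
  by (simp add: largest_part_def)

lemma largest_part_ge: "x \<in> set xs \<Longrightarrow> x \<le> largest_part xs"
  by (auto simp: largest_part_def)

lemma largest_part_Cons: "sorted_wrt (\<ge>) (x # xs) \<Longrightarrow> largest_part (x # xs) = x"
  by (auto simp: largest_part_def intro!: Max_eqI)

lemma largest_part_in: "0 < largest_part xs \<Longrightarrow> largest_part xs \<in> set xs"
  using Max_in[of "set xs"] by (auto simp: largest_part_def split: if_splits)

lemma chain_excludants_Nil [simp]: "chain_excludants [] r = {}"
  by (simp add: chain_excludants_def)

lemma chain_excludants_ge: "k \<in> chain_excludants xs r \<Longrightarrow> r \<ge> 1 \<Longrightarrow> r \<le> k"
  unfolding chain_excludants_def by (auto dest!: spec[of _ "r - 1"])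

text \<open>Prepending a new largest part \<open>x\<close> can only create chains inside the new gap between
  \<open>x\<close> and the old largest part: a chain has no room for a part, so it cannot straddle one.\<close>

lemma chain_excludants_Cons:
  assumes "sorted_wrt (\<ge>) (x # xs)" "r \<ge> 1"
  shows "chain_excludants (x # xs) r
    = chain_excludants xs r \<union> {largest_part xs + r..<x}" (is "?L = ?R")
proof (rule set_eqI)
  fix k
  have lx: "largest_part xs \<le> x"
    using assms largest_part_in[of xs] by (cases "largest_part xs = 0") auto
  show "k \<in> ?L \<longleftrightarrow> k \<in> ?R"
  proof (cases "k < largest_part xs")
    case True
    then show ?thesis
      using lx by (auto simp: chain_excludants_def largest_part_Cons[OF assms(1)])
  next
    case False
    show ?thesis
    proof
      assume k: "k \<in> ?L"
      have "largest_part xs + r \<le> k"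
      proof (rule ccontr)
        assume "\<not> ?thesis"
        hence i: "k - largest_part xs < r" "k - (k - largest_part xs) = largest_part xs"
          using False by auto
        hence "largest_part xs \<notin> set xs" "k - largest_part xs < k"
          using k unfolding chain_excludants_def by (auto dest!: spec[of _ "k - largest_part xs"])
        thus False using largest_part_in[of xs] by linarith
      qed
      thus "k \<in> ?R"
        using k by (auto simp: chain_excludants_def largest_part_Cons[OF assms(1)])
    next
      assume "k \<in> ?R"
      hence k: "largest_part xs + r \<le> k" "k < x"
        using False by (auto simp: chain_excludants_def)
      have "k - i \<notin> set xs" if "i < r" for i
        using largest_part_ge[of "k - i" xs] k that by auto
      with k assms(2) show "k \<in> ?L"
        by (auto simp: chain_excludants_def largest_part_Cons[OF assms(1)])
    qed
  qed
qed

lemma partitions_0_Cons: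
  assumes "x # xs \<in> partitions n"
  shows "x # xs \<in> partitions_0 r n \<longleftrightarrow>
    xs \<in> partitions_0 r (sum_list xs) \<and> x \<le> largest_part xs + r"
proof (cases xs)
  case Nil
  then show ?thesis using assms by (auto simp: partitions_0_def partitions_def)
next
  case (Cons y ys)
  have y: "largest_part xs = y"
    using assms Cons by (auto simp: partitions_def intro!: largest_part_Cons)
  have "(\<forall>i. Suc i < length (x # xs) \<longrightarrow> (x # xs) ! i - (x # xs) ! Suc i \<le> r) \<longleftrightarrow>
    x - y \<le> r \<and> (\<forall>i. Suc i < length xs \<longrightarrow> xs ! i - xs ! Suc i \<le> r)"
    (is "(\<forall>i. ?P i) \<longleftrightarrow> ?Q")
  proof -
    have "(\<forall>i. ?P i) \<longleftrightarrow> ?P 0 \<and> (\<forall>i. ?P (Suc i))"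
      by (metis not0_implies_Suc)
    thus ?thesis unfolding Cons by simp
  qed
  then show ?thesis
    using assms y Cons by (auto simp: partitions_0_def partitions_def)
qed

text \<open>A gap exceeding \<open>r\<close> (below the smallest part, the gap down to \<open>0\<close>) is the same thing as
  \<open>r\<close> consecutive positive non-parts below the largest part. Hence \<open>Omega r\<close>, like \<open>maex\<close>, is a
  function of the chain excludants alone, and only these need to be tracked below.\<close>

lemma partitions_0_iff:
  assumes "xs \<in> partitions n" "r \<ge> 1"
  shows "xs \<in> partitions_0 r n \<longleftrightarrow> chain_excludants xs r = {}"
  using assms(1)
proof (induction xs arbitrary: n)
  case Nil
  then show ?case by (auto simp: partitions_0_def)
next
  case (Cons x xs)
  have "xs \<in> partitions (sum_list xs)" and s: "sorted_wrt (\<ge>) (x # xs)"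
    using Cons.prems by (auto simp: partitions_def)
  with Cons.IH show ?case
    unfolding partitions_0_Cons[OF Cons.prems] chain_excludants_Cons[OF s assms(2)]
    by auto
qed

section \<open>Adding columns\<close>

text \<open>Padding \<open>xs\<close> with zeros to length \<open>N\<close> and adding \<open>m\<close> to every entry. In terms of Ferrers diagrams,
  this inserts \<open>m\<close> columns of height \<open>N\<close>, i.e. \<open>m\<close> parts equal to \<open>N\<close> into the conjugate partition.
  For \<open>m = 0\<close> the padding has to be dropped again, since parts are positive.\<close>

definition add_columns :: "nat \<Rightarrow> nat \<Rightarrow> nat list \<Rightarrow> nat list" where
  "add_columns N m xs =
     (if m = 0 then xs else map (\<lambda>x. x + m) xs @ replicate (N - length xs) m)"

text \<open>The inverse operation: the number of columns of full height \<open>N\<close> is the \<open>N\<close>-th part, which is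
  \<open>last ys\<close> if \<open>ys\<close> has length \<open>N\<close> and \<open>0\<close> if it is shorter.\<close>

definition remove_columns :: "nat \<Rightarrow> nat list \<Rightarrow> nat \<times> nat list" where
  "remove_columns N ys = (if length ys < N then (0, ys) else
     (last ys, map (\<lambda>y. y - last ys) (filter (\<lambda>y. last ys < y) ys)))"

text \<open>The parts equal to the smallest part form the end of the list; so the padding that
  \<open>remove_columns\<close> throws away can be recovered from the length.\<close>

lemma filter_greater_append_replicate:
  fixes ys :: "nat list"
  assumes "sorted_wrt (\<ge>) ys" "\<forall>y\<in>set ys. m \<le> y"
  shows "filter (\<lambda>y. m < y) ys @ replicate (length ys - length (filter (\<lambda>y. m < y) ys)) m = ys"
  using assms
proof (induction ys)
  case (Cons y ys)
  show ?case
  proof (cases "m < y")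
    case True
    then show ?thesis using Cons by simp
  next
    case False
    hence "\<forall>z\<in>set (y # ys). z = m" using Cons.prems by force
    then show ?thesis by (auto intro!: replicate_eqI[symmetric])
  qed
qed simp

lemma add_columns_in:
  assumes "xs \<in> partitions_upto N"
  shows "add_columns (Suc N) m xs \<in> partitions_upto (Suc N)"
proof -
  have "sorted_wrt (\<ge>) (replicate k m)" for k
    by (induction k) auto
  thus ?thesis
    using assms by (auto simp: partitions_upto_def add_columns_def sorted_wrt_append sorted_wrt_map)
qed

lemma remove_add_columns:
  assumes "xs \<in> partitions_upto N"
  shows "remove_columns (Suc N) (add_columns (Suc N) m xs) = (m, xs)"
proof (cases "m = 0")
  case True
  then show ?thesis using assms by (auto simp: partitions_upto_def add_columns_def remove_columns_def)
next
  case False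
  have "filter (\<lambda>x. 0 < x) xs = xs"
    using assms by (auto simp: partitions_upto_def)
  then show ?thesis using assms False
    by (auto simp: partitions_upto_def add_columns_def remove_columns_def filter_map o_def)
qed

lemma remove_columns_in:
  assumes "ys \<in> partitions_upto (Suc N)"
  shows "remove_columns (Suc N) ys \<in> UNIV \<times> partitions_upto N"
proof (cases "length ys < Suc N")
  case True
  then show ?thesis using assms by (auto simp: partitions_upto_def remove_columns_def)
next
  case False
  hence ne: "ys \<noteq> []" by auto
  have "length (filter (\<lambda>y. last ys < y) ys) < length ys"
    using ne by (intro length_filter_less[of "last ys"]) auto
  moreover have "sorted_wrt (\<lambda>x y. y - last ys \<le> x - last ys) (filter (\<lambda>y. last ys < y) ys)"
    using assms by (auto simp: partitions_upto_def intro!: sorted_wrt_filter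
      elim: sorted_wrt_mono_rel[rotated])
  ultimately show ?thesis using assms False
    by (auto simp: partitions_upto_def remove_columns_def sorted_wrt_map)
qed

lemma add_remove_columns:
  assumes "ys \<in> partitions_upto (Suc N)"
  shows "(\<lambda>(m, xs). add_columns (Suc N) m xs) (remove_columns (Suc N) ys) = ys"
proof (cases "length ys < Suc N")
  case True
  then show ?thesis by (simp add: remove_columns_def add_columns_def)
next
  case False
  hence ne: "ys \<noteq> []" and len: "length ys = Suc N" using assms by (auto simp: partitions_upto_def)
  have s: "sorted_wrt (\<ge>) ys" using assms by (simp add: partitions_upto_def)
  have "last ys \<le> y" if "y \<in> set ys" for y
  proof -
    have "sorted_wrt (\<ge>) (butlast ys @ [last ys])" "y \<in> set (butlast ys @ [last ys])"
      using s ne that by simp_all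
    thus ?thesis unfolding sorted_wrt_append by auto
  qed
  hence "\<forall>y\<in>set ys. last ys \<le> y" by blast
  note f = filter_greater_append_replicate[OF s this]
  have "map (\<lambda>y. y - last ys + last ys) (filter (\<lambda>y. last ys < y) ys) = filter (\<lambda>y. last ys < y) ys"
    by (rule map_idI) auto
  moreover have "0 < last ys" using assms ne by (auto simp: partitions_upto_def)
  ultimately show ?thesis using f len False
    by (simp add: remove_columns_def add_columns_def o_def)
qed

lemma sum_list_add_columns:
  assumes "length xs \<le> N"
  shows "sum_list (add_columns N m xs) = N * m + sum_list xs"
proof -
  have "sum_list (map (\<lambda>x. x + m) xs) = sum_list xs + length xs * m"
    by (induction xs) auto
  moreover have "length xs * m + (N - length xs) * m = N * m"
    using assms by (simp flip: distrib_right)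
  ultimately show ?thesis by (simp add: add_columns_def sum_list_replicate)
qed

lemma largest_part_add_columns:
  assumes "xs \<in> partitions_upto N"
  shows "largest_part (add_columns (Suc N) m xs) = largest_part xs + m"
proof (cases "m = 0")
  case False
  have "x \<le> largest_part xs + m" if "x \<in> set (add_columns (Suc N) m xs)" for x
    using that largest_part_ge[of _ xs] False by (auto simp: add_columns_def)
  moreover have "largest_part xs + m \<in> set (add_columns (Suc N) m xs)"
    using largest_part_in[of xs] False assms
    by (cases "largest_part xs = 0") (auto simp: add_columns_def partitions_upto_def)
  moreover from this have "add_columns (Suc N) m xs \<noteq> []" by auto
  ultimately show ?thesis
    unfolding largest_part_def[of "add_columns (Suc N) m xs"] by (auto intro!: Max_eqI)
qed (simp add: add_columns_def)

text \<open>Adding \<open>m\<close> columns to a partition with a spare row makes \<open>m\<close> the smallest part (if \<open>m > 0\<close>).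
  The old chains are shifted by \<open>m\<close>, and new ones appear only below \<open>m\<close>; as \<open>m\<close> itself is a part,
  no chain crosses it.\<close>

lemma chain_excludants_add_columns:
  assumes "xs \<in> partitions_upto N" "r \<ge> 1"
  shows "chain_excludants (add_columns (Suc N) m xs) r
    = {r..<m} \<union> (\<lambda>k. k + m) ` chain_excludants xs r" (is "?L = ?R")
proof (cases "m = 0")
  case False
  have mem: "x \<in> set (add_columns (Suc N) m xs) \<longleftrightarrow> x = m \<or> (m < x \<and> x - m \<in> set xs)" for x
    using False assms by (force simp: add_columns_def partitions_upto_def)
  show ?thesis
  proof (intro equalityI subsetI)
    fix k assume k: "k \<in> ?L"
    note kr = chain_excludants_ge[OF k assms(2)]
    show "k \<in> ?R"
    proof (cases "k < m")
      case True
      then show ?thesis using kr by auto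
    next
      case False
      have "r + m \<le> k"
      proof (rule ccontr)
        assume "\<not> ?thesis"
        hence "k - m < r" "k - (k - m) = m" using False by auto
        thus False using k mem unfolding chain_excludants_def by fastforce
      qed
      have "k - m - i \<notin> set xs" if "i < r" for i
      proof -
        have "k - i \<notin> set (add_columns (Suc N) m xs)" using k that by (auto simp: chain_excludants_def)
        moreover have "m < k - i" "k - i - m = k - m - i" using that \<open>r + m \<le> k\<close> by auto
        ultimately show ?thesis using mem by metis
      qed
      hence "k - m \<in> chain_excludants xs r"
        using k \<open>r + m \<le> k\<close> assms(2)
        by (auto simp: chain_excludants_def largest_part_add_columns[OF assms(1)])
      thus ?thesis using False by (auto intro!: image_eqI[of _ _ "k - m"])
    qed
  next
    fix k assume "k \<in> ?R"
    thus "k \<in> ?L"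
    proof
      assume "k \<in> {r..<m}"
      thus ?thesis using assms(2)
        by (auto simp: chain_excludants_def largest_part_add_columns[OF assms(1)] mem)
    next
      assume "k \<in> (\<lambda>k. k + m) ` chain_excludants xs r"
      then obtain j where j: "k = j + m" "j \<in> chain_excludants xs r" by auto
      note jr = chain_excludants_ge[OF j(2) assms(2)]
      have "j + m - i - m = j - i" for i by simp
      thus ?thesis using j jr
        by (auto simp: chain_excludants_def largest_part_add_columns[OF assms(1)] mem)
    qed
  qed
qed (simp add: add_columns_def)

lemma maex_le_largest_part: "maex xs r \<le> largest_part xs"
proof -
  have "maex xs r \<in> chain_excludants xs r" if "chain_excludants xs r \<noteq> {}"
    using Max_in[OF finite_chain_excludants that] that by (simp add: maex_def)
  thus ?thesis by (auto simp: maex_def chain_excludants_def split: if_splits)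
qed

section \<open>The weight\<close>

text \<open>The subtraction is not truncated, by \<open>maex_le_largest_part\<close>.\<close>

definition weight :: "nat \<Rightarrow> nat list \<Rightarrow> nat" where
  "weight r xs = largest_part xs - maex xs r + Omega r xs"

lemma Omega_eq:
  assumes "xs \<in> partitions_upto N" "r \<ge> 1"
  shows "Omega r xs = (if chain_excludants xs r = {} then 1 else r)"
proof -
  have "xs \<in> partitions (sum_list xs)"
    using assms by (auto simp: partitions_upto_def partitions_def)
  from partitions_0_iff[OF this assms(2)] show ?thesis by (simp add: Omega_def)
qed

text \<open>If \<open>xs\<close> already has a chain, then the largest part and \<open>maex\<close> are both shifted by \<open>m\<close> and
  the weight does not change. If it has none, then for \<open>m \<le> r\<close> the largest part grows by \<open>m\<close>
  and \<open>maex\<close> stays \<open>0\<close>, while for \<open>m > r\<close> the largest chain excludant becomes \<open>m - 1\<close>: the difference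
  of largest part and \<open>maex\<close> grows by \<open>1\<close> and \<open>Omega\<close> by \<open>r - 1\<close>. This is the point at which the value
  \<open>r\<close> of \<open>Omega\<close> matters: it makes the total increase exactly \<open>r\<close> for every \<open>m > r\<close>.\<close>

lemma weight_add_columns:
  assumes "xs \<in> partitions_upto N" "r \<ge> 1"
  shows "weight r (add_columns (Suc N) m xs)
    = weight r xs + (if chain_excludants xs r = {} then min m r else 0)"
proof -
  let ?E = "chain_excludants xs r" and ?E' = "chain_excludants (add_columns (Suc N) m xs) r"
  note E' = chain_excludants_add_columns[OF assms, of m]
  note W = weight_def largest_part_add_columns[OF assms(1)]
    Omega_eq[OF assms] Omega_eq[OF add_columns_in[OF assms(1)] assms(2)]
  show ?thesis
  proof (cases "?E = {}")
    case True
    show ?thesis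
    proof (cases "m \<le> r")
      case le: True
      hence "?E' = {}" using True E' by simp
      thus ?thesis using True le by (simp add: W maex_def)
    next
      case False
      hence "?E' = {r..<m}" "?E' \<noteq> {}" using True E' by auto
      moreover have "Max {r..<m} = m - 1" using False by (intro Max_eqI) auto
      ultimately have "maex (add_columns (Suc N) m xs) r = m - 1" by (simp add: maex_def)
      thus ?thesis using True False \<open>?E' \<noteq> {}\<close> assms(2) by (simp add: W maex_def)
    qed
  next
    case False
    hence ne: "?E' \<noteq> {}" using E' by auto
    have "Max ?E' = Max ?E + m"
    proof (rule Max_eqI)
      show "finite ?E'" by (rule finite_chain_excludants)
      show "Max ?E + m \<in> ?E'"
        unfolding E' using Max_in[OF finite_chain_excludants False] by blast
      fix k assume "k \<in> ?E'"
      thus "k \<le> Max ?E + m"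
        unfolding E' using Max_ge[OF finite_chain_excludants, of _ xs r] by auto
    qed
    thus ?thesis using False ne by (simp add: W maex_def)
  qed
qed

section \<open>Sums over infinite index sets\<close>

lemma has_sum_mult_Times:
  fixes f :: "'a \<Rightarrow> complex" and g :: "'b \<Rightarrow> complex"
  assumes f: "(f has_sum a) A" and g: "(g has_sum b) B"
  shows "((\<lambda>(x, y). f x * g y) has_sum (a * b)) (A \<times> B)"
proof (rule has_sum_SigmaI)
  show "((\<lambda>y. case (x, y) of (x, y) \<Rightarrow> f x * g y) has_sum f x * b) B" for x
    using has_sum_cmult_right[OF g, of "f x"] by simp
  show "((\<lambda>x. f x * b) has_sum a * b) A"
    by (rule has_sum_cmult_left[OF f])
  have fa: "(\<lambda>x. norm (f x)) summable_on A" and ga: "(\<lambda>y. norm (g y)) summable_on B"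
    using f g summable_on_iff_abs_summable_on_complex has_sum_imp_summable by blast+
  have "(\<lambda>(x, y). norm (f x) * norm (g y)) summable_on A \<times> B"
    by (rule summable_on_SigmaI[where g = "\<lambda>x. norm (f x) * infsum (\<lambda>y. norm (g y)) B"])
      (auto intro!: has_sum_cmult_right has_sum_infsum ga summable_on_cmult_left fa)
  hence "(\<lambda>p. norm ((\<lambda>(x, y). f x * g y) p)) summable_on A \<times> B"
    by (simp add: case_prod_unfold norm_mult)
  thus "(\<lambda>(x, y). f x * g y) summable_on A \<times> B"
    by (rule abs_summable_summable)
qed

lemma has_sum_imp_sums_fibres:
  fixes f :: "'a \<Rightarrow> complex" and h :: "'a \<Rightarrow> nat"
  assumes "(f has_sum S) A"
  shows "(\<lambda>n. infsum f {x\<in>A. h x = n}) sums S"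
proof -
  have "((\<lambda>(n, x). f x) has_sum S) (Sigma UNIV (\<lambda>n. {x\<in>A. h x = n})) \<longleftrightarrow> (f has_sum S) A"
    by (rule has_sum_reindex_bij_witness[where i = "\<lambda>x. (h x, x)" and j = snd]) auto
  with assms have "((\<lambda>(n, x). f x) has_sum S) (Sigma UNIV (\<lambda>n. {x\<in>A. h x = n}))" by simp
  moreover have "((\<lambda>x. case (n, x) of (n, x) \<Rightarrow> f x) has_sum infsum f {x\<in>A. h x = n}) {x\<in>A. h x = n}"
    for n
    using summable_on_subset_banach[OF has_sum_imp_summable[OF assms], of "{x\<in>A. h x = n}"]
    by (auto intro: has_sum_infsum)
  ultimately have "((\<lambda>n. infsum f {x\<in>A. h x = n}) has_sum S) UNIV"
    by (rule has_sum_SigmaD)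
  thus ?thesis by (rule has_sum_imp_sums)
qed

text \<open>The sublevel sets of \<open>h\<close> may be infinite, as are the sets of partitions with at most \<open>N\<close> parts.\<close>

lemma infsum_upto_tendsto:
  fixes f :: "'a \<Rightarrow> complex" and h :: "'a \<Rightarrow> nat"
  assumes "(f has_sum S) A"
  shows "(\<lambda>N. infsum f {x\<in>A. h x \<le> N}) \<longlonglongrightarrow> S"
proof -
  have sub: "f summable_on {x\<in>A. P x}" for P
    by (rule summable_on_subset_banach[OF has_sum_imp_summable[OF assms]]) auto
  have "(\<Sum>n\<le>N. infsum f {x\<in>A. h x = n}) = infsum f {x\<in>A. h x \<le> N}" for N
  proof (induction N)
    case (Suc N)
    have "infsum f ({x\<in>A. h x \<le> N} \<union> {x\<in>A. h x = Suc N})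
      = infsum f {x\<in>A. h x \<le> N} + infsum f {x\<in>A. h x = Suc N}"
      by (rule infsum_Un_disjoint) (auto intro: sub)
    also have "{x\<in>A. h x \<le> N} \<union> {x\<in>A. h x = Suc N} = {x\<in>A. h x \<le> Suc N}" by auto
    finally show ?case using Suc by simp
  qed simp
  with has_sum_imp_sums_fibres[OF assms, of h] show ?thesis
    by (simp add: sums_def_le)
qed

section \<open>Generating functions for a bounded number of parts\<close>

lemma has_sum_geometric:
  fixes x :: complex
  assumes "norm x < 1"
  shows "((\<lambda>m. x ^ m) has_sum 1 / (1 - x)) UNIV"
  using assms
  by (intro norm_summable_imp_has_sum geometric_sums) (auto simp: norm_power summable_geometric)

text \<open>By induction on \<open>r\<close>: passing from \<open>min m r\<close> to \<open>min m (Suc r)\<close> adds \<open>1\<close> for every \<open>m > r\<close>, that is,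
  the tail of a geometric series.\<close>

lemma has_sum_geometric_min:
  fixes x :: complex
  assumes "norm x < 1"
  shows "((\<lambda>m. of_nat (min m r) * x ^ m) has_sum x * (1 - x ^ r) / (1 - x)\<^sup>2) UNIV"
proof (induction r)
  case 0
  show ?case by simp
next
  case (Suc r)
  have x1: "1 - x \<noteq> 0" using assms by auto
  have "((\<lambda>m. x ^ (m + Suc r)) has_sum x ^ Suc r / (1 - x)) UNIV"
    using has_sum_cmult_right[OF has_sum_geometric[OF assms], of "x ^ Suc r"]
    by (simp add: power_add mult_ac)
  also have "?this \<longleftrightarrow> ((\<lambda>m. x ^ m) has_sum x ^ Suc r / (1 - x)) {Suc r..}"
    by (rule has_sum_reindex_bij_witness[where i = "\<lambda>m. m - Suc r" and j = "\<lambda>m. m + Suc r"]) auto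
  also have "\<dots> \<longleftrightarrow> ((\<lambda>m. if r < m then x ^ m else 0) has_sum x ^ Suc r / (1 - x)) UNIV"
    by (rule has_sum_cong_neutral) auto
  finally have "((\<lambda>m. of_nat (min m r) * x ^ m + (if r < m then x ^ m else 0))
    has_sum x * (1 - x ^ r) / (1 - x)\<^sup>2 + x ^ Suc r / (1 - x)) UNIV"
    by (intro has_sum_add[OF Suc])
  moreover have "of_nat (min m r) * x ^ m + (if r < m then x ^ m else 0)
    = of_nat (min m (Suc r)) * x ^ m" for m
    by (auto simp: min_def algebra_simps not_le less_Suc_eq_le le_Suc_eq)
  moreover have "x * (1 - x ^ r) / (1 - x)\<^sup>2 + x ^ Suc r / (1 - x) = x * (1 - x ^ Suc r) / (1 - x)\<^sup>2"
    using x1 by (simp add: divide_simps) (simp add: algebra_simps power2_eq_square)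
  ultimately show ?case by simp
qed

lemma has_sum_geometric_atMost:
  fixes x :: complex
  assumes "norm x < 1"
  shows "((\<lambda>m. of_bool (m \<le> r) * x ^ m) has_sum (1 - x ^ Suc r) / (1 - x)) UNIV"
proof -
  have "(\<Sum>m\<le>r. x ^ m) = (1 - x ^ Suc r) / (1 - x)"
    using assms sum_gp0[of x r] by auto
  hence "(\<Sum>m\<in>{..r}. of_bool (m \<le> r) * x ^ m) = (1 - x ^ Suc r) / (1 - x)"
    by (subst sum.cong[OF refl, of _ _ "\<lambda>m. x ^ m"]) auto
  thus ?thesis
    by (intro has_sum_finite_neutralI[where B = "{..r}"]) auto
qed

lemma has_sum_partitions_upto_Suc:
  fixes f :: "nat list \<Rightarrow> complex"
  shows "(f has_sum S) (partitions_upto (Suc N)) \<longleftrightarrow>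
    ((\<lambda>(m, xs). f (add_columns (Suc N) m xs)) has_sum S) (UNIV \<times> partitions_upto N)"
  by (rule sym, rule has_sum_reindex_bij_witness[where
      i = "remove_columns (Suc N)" and j = "\<lambda>(m, xs). add_columns (Suc N) m xs"])
    (use remove_columns_in in \<open>auto simp: remove_add_columns add_columns_in add_remove_columns\<close>)

lemma norm_power_Suc_less_1: "norm (q :: complex) < 1 \<Longrightarrow> norm (q ^ Suc N) < 1"
  using power_Suc_less_one[of "norm q" N] by (cases "q = 0") (auto simp: norm_power norm_mult)

lemma one_minus_power_nonzero: "norm (q :: complex) < 1 \<Longrightarrow> 1 - q ^ Suc N \<noteq> 0"
  using norm_power_Suc_less_1[of q N] by auto

lemma qpoch_nonzero:
  assumes "norm q < 1"
  shows "qpoch q q N \<noteq> 0"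
  using one_minus_power_nonzero[OF assms] by (simp add: qpoch_def)

lemma qpoch_power_Suc:
  "qpoch (q ^ k) (q ^ k) (Suc N) = qpoch (q ^ k) (q ^ k) N * (1 - (q ^ Suc N) ^ k)"
proof -
  have "q ^ k * (q ^ k) ^ N = (q ^ Suc N) ^ k"
    by (simp add: power_mult_distrib mult.commute flip: power_mult)
  thus ?thesis by (simp add: qpoch_def)
qed

text \<open>Conjugation turns the condition into a bound on multiplicities: each part of the conjugate
  occurs at most \<open>r\<close> times. So every \<open>i \<le> N\<close> contributes the factor
  \<open>1 + q ^ i + \<dots> + q ^ (r * i) = (1 - q ^ ((r + 1) * i)) / (1 - q ^ i)\<close>.\<close>

lemma gf_no_chain:
  fixes q :: complex
  assumes "r \<ge> 1" "norm q < 1"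
  shows "((\<lambda>xs. of_bool (chain_excludants xs r = {}) * q ^ sum_list xs)
    has_sum qpoch (q ^ Suc r) (q ^ Suc r) N / qpoch q q N) (partitions_upto N)"
proof (induction N)
  case 0
  show ?case by (simp add: partitions_upto_0 qpoch_def has_sum_finite_iff)
next
  case (Suc N)
  let ?x = "q ^ Suc N" and ?e = "\<lambda>xs. of_bool (chain_excludants xs r = {}) :: complex"
  have "((\<lambda>(m, xs). (of_bool (m \<le> r) * ?x ^ m) * (?e xs * q ^ sum_list xs)) has_sum
      (1 - ?x ^ Suc r) / (1 - ?x) * (qpoch (q ^ Suc r) (q ^ Suc r) N / qpoch q q N))
      (UNIV \<times> partitions_upto N)"
    by (intro has_sum_mult_Times has_sum_geometric_atMost Suc norm_power_Suc_less_1 assms)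
  also have "(1 - ?x ^ Suc r) / (1 - ?x) * (qpoch (q ^ Suc r) (q ^ Suc r) N / qpoch q q N)
      = qpoch (q ^ Suc r) (q ^ Suc r) (Suc N) / qpoch q q (Suc N)"
    using qpoch_power_Suc[of q 1 N] unfolding qpoch_power_Suc[of q "Suc r"]
    by (simp only: power_one_right times_divide_times_eq mult.commute)
  finally have hs: "((\<lambda>(m, xs). (of_bool (m \<le> r) * ?x ^ m) * (?e xs * q ^ sum_list xs)) has_sum
      qpoch (q ^ Suc r) (q ^ Suc r) (Suc N) / qpoch q q (Suc N)) (UNIV \<times> partitions_upto N)" .
  have eq: "(of_bool (m \<le> r) * ?x ^ m) * (?e xs * q ^ sum_list xs)
      = ?e (add_columns (Suc N) m xs) * q ^ sum_list (add_columns (Suc N) m xs)"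
    if xs: "xs \<in> partitions_upto N" for m xs
  proof -
    have "length xs \<le> Suc N" using xs by (auto simp: partitions_upto_def)
    from sum_list_add_columns[OF this, of m]
    have "q ^ sum_list (add_columns (Suc N) m xs) = ?x ^ m * q ^ sum_list xs"
      by (simp only: power_add power_mult)
    moreover have "?e (add_columns (Suc N) m xs) = of_bool (m \<le> r) * ?e xs"
      by (simp add: chain_excludants_add_columns[OF xs assms(1)])
    ultimately show ?thesis by (simp only: mult_ac)
  qed
  show ?case
    unfolding has_sum_partitions_upto_Suc
    by (rule iffD1[OF has_sum_cong hs], clarify) (simp only: prod.case eq)
qed

text \<open>By \<open>weight_add_columns\<close>, adding the columns of height \<open>N + 1\<close>, with \<open>x = q ^ (N + 1)\<close>, sends the
  generating function \<open>G\<close> to \<open>G / (1 - x) + B * x * (1 - x ^ r) / (1 - x)\<^sup>2\<close>, where \<open>B\<close> is the generating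
  function of the partitions without chains. The closed form satisfies the same recurrence.\<close>

lemma gf_weight:
  fixes q :: complex and r :: nat
  assumes "r \<ge> 1" "norm q < 1"
  defines "P \<equiv> qpoch (q ^ Suc r) (q ^ Suc r)"
  shows "((\<lambda>xs. of_nat (weight r xs) * q ^ sum_list xs)
    has_sum (P N / qpoch q q N
      + 1 / qpoch q q N * (\<Sum>n<N. q ^ Suc n * P (Suc n) / (1 - q ^ Suc n)))) (partitions_upto N)"
proof (induction N)
  case 0
  have "weight r [] = 1" by (simp add: weight_def maex_def Omega_def partitions_0_def partitions_def)
  then show ?case by (simp add: partitions_upto_0 qpoch_def P_def has_sum_finite_iff)
next
  case (Suc N)
  let ?x = "q ^ Suc N" and ?e = "\<lambda>xs. of_bool (chain_excludants xs r = {}) :: complex"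
  let ?T = "\<Sum>n<N. q ^ Suc n * P (Suc n) / (1 - q ^ Suc n)"
  let ?f = "\<lambda>p. (\<lambda>(m, xs). ?x ^ m * (of_nat (weight r xs) * q ^ sum_list xs)) p
        + (\<lambda>(m, xs). (of_nat (min m r) * ?x ^ m) * (?e xs * q ^ sum_list xs)) p"
  have x: "norm ?x < 1" by (rule norm_power_Suc_less_1[OF assms(2)])
  have "(?f has_sum
      1 / (1 - ?x) * (P N / qpoch q q N + 1 / qpoch q q N * ?T)
      + ?x * (1 - ?x ^ r) / (1 - ?x)\<^sup>2 * (P N / qpoch q q N))
      (UNIV \<times> partitions_upto N)"
    unfolding P_def
    by (intro has_sum_add has_sum_mult_Times has_sum_geometric has_sum_geometric_min x
      Suc[unfolded P_def] gf_no_chain[OF assms(1,2)])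
  also have "1 / (1 - ?x) * (P N / qpoch q q N + 1 / qpoch q q N * ?T)
      + ?x * (1 - ?x ^ r) / (1 - ?x)\<^sup>2 * (P N / qpoch q q N)
    = P (Suc N) / qpoch q q (Suc N)
      + 1 / qpoch q q (Suc N) * (\<Sum>n<Suc N. q ^ Suc n * P (Suc n) / (1 - q ^ Suc n))"
  proof -
    have PS: "P (Suc N) = P N * (1 - ?x * ?x ^ r)"
      unfolding P_def qpoch_power_Suc by simp
    have QS: "qpoch q q (Suc N) = qpoch q q N * (1 - ?x)" by (simp add: qpoch_def)
    \<comment> \<open>With \<open>y = x ^ r\<close>, the recurrence is a rational identity in independent quantities.\<close>
    have "1 / (1 - x) * (p / Q + 1 / Q * T) + x * (1 - y) / (1 - x)\<^sup>2 * (p / Q)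
      = p * (1 - x * y) / (Q * (1 - x)) + 1 / (Q * (1 - x)) * (T + x * (p * (1 - x * y)) / (1 - x))"
      if "Q \<noteq> 0" "1 - x \<noteq> 0" for x y p Q T :: complex
      using that by (simp add: divide_simps) (simp add: algebra_simps power2_eq_square)
    from this[OF qpoch_nonzero[OF assms(2)] one_minus_power_nonzero[OF assms(2)]] show ?thesis
      unfolding sum.lessThan_Suc PS QS .
  qed
  finally have hs: "(?f has_sum P (Suc N) / qpoch q q (Suc N)
      + 1 / qpoch q q (Suc N) * (\<Sum>n<Suc N. q ^ Suc n * P (Suc n) / (1 - q ^ Suc n)))
      (UNIV \<times> partitions_upto N)" .
  have eq: "?x ^ m * (of_nat (weight r xs) * q ^ sum_list xs)
        + (of_nat (min m r) * ?x ^ m) * (?e xs * q ^ sum_list xs)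
      = of_nat (weight r (add_columns (Suc N) m xs)) * q ^ sum_list (add_columns (Suc N) m xs)"
    if xs: "xs \<in> partitions_upto N" for m xs
  proof -
    have "length xs \<le> Suc N" using xs by (auto simp: partitions_upto_def)
    from sum_list_add_columns[OF this, of m]
    have q: "q ^ sum_list (add_columns (Suc N) m xs) = ?x ^ m * q ^ sum_list xs"
      by (simp only: power_add power_mult)
    have w: "of_nat (weight r (add_columns (Suc N) m xs)) = of_nat (weight r xs) + of_nat (min m r) * ?e xs"
      by (simp add: weight_add_columns[OF xs assms(1)])
    show ?thesis unfolding q w by (simp only: distrib_left distrib_right mult_ac)
  qed
  show ?case
    unfolding has_sum_partitions_upto_Suc
    by (rule iffD1[OF has_sum_cong hs], clarify) (simp only: prod.case eq)
qed

section \<open>Letting the number of parts tend to infinity\<close>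

lemma gf_weight_tendsto:
  fixes q :: complex and r :: nat
  assumes "norm q < 1"
  defines "P \<equiv> qpoch (q ^ Suc r) (q ^ Suc r)"
  shows "(\<lambda>N. P N / qpoch q q N
      + 1 / qpoch q q N * (\<Sum>n<N. q ^ Suc n * P (Suc n) / (1 - q ^ Suc n)))
    \<longlonglongrightarrow> qpoch_inf (q ^ Suc r) (q ^ Suc r) / qpoch_inf q q
      + 1 / qpoch_inf q q * (\<Sum>n. q ^ Suc n * P (Suc n) / (1 - q ^ Suc n))"
proof -
  have "1 - q * q ^ i \<noteq> 0" for i
    using one_minus_power_nonzero[OF assms(1), of i] by simp
  hence "qpoch_inf q q \<noteq> 0"
    unfolding qpoch_inf_def by (rule prodinf_nonzero[OF convergent_prod_qpoch[OF assms(1)]])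
  thus ?thesis unfolding P_def
    by (intro tendsto_intros qpoch_tendsto_qpoch_inf summable_LIMSEQ summable_rhs
      norm_power_Suc_less_1 assms(1))
qed

text \<open>The weights are nonnegative, so the absolute values of the terms are the terms for \<open>norm q\<close> in
  place of \<open>q\<close>. Every finite set of partitions has a bounded number of parts, and the sums over these
  bounded families are known and convergent, hence bounded.\<close>

lemma summable_weight:
  fixes q :: complex
  assumes "r \<ge> 1" "norm q < 1"
  shows "(\<lambda>xs. of_nat (weight r xs) * q ^ sum_list xs) summable_on (\<Union>N. partitions_upto N)"
proof (rule abs_summable_summable, unfold abs_summable_iff_bdd_above)
  let ?t = "complex_of_real (norm q)"
  define G where "G N = qpoch (?t ^ Suc r) (?t ^ Suc r) N / qpoch ?t ?t N
      + 1 / qpoch ?t ?t N *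
        (\<Sum>n<N. ?t ^ Suc n * qpoch (?t ^ Suc r) (?t ^ Suc r) (Suc n) / (1 - ?t ^ Suc n))" for N
  have t: "norm ?t < 1" using assms by simp
  have "Bseq G"
    unfolding G_def by (rule convergent_imp_Bseq, rule convergentI, rule gf_weight_tendsto[OF t])
  then obtain K where K: "\<And>N. norm (G N) \<le> K" by (elim BseqE) blast
  show "bdd_above (sum (\<lambda>xs. norm (of_nat (weight r xs) * q ^ sum_list xs)) `
    {F. F \<subseteq> (\<Union>N. partitions_upto N) \<and> finite F})"
  proof (rule bdd_aboveI2)
    fix F assume F: "F \<in> {F. F \<subseteq> (\<Union>N. partitions_upto N) \<and> finite F}"
    define N where "N = Max (insert 0 (length ` F))"
    have "length xs \<le> N" if "xs \<in> F" for xs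
      unfolding N_def using F that by (intro Max_ge) auto
    hence FN: "F \<subseteq> partitions_upto N" using F by (fastforce simp: partitions_upto_def)
    have "((\<lambda>xs. Re (of_nat (weight r xs) * ?t ^ sum_list xs)) has_sum Re (G N)) (partitions_upto N)"
      unfolding G_def by (intro has_sum_Re gf_weight assms(1) t)
    hence "((\<lambda>xs. norm (of_nat (weight r xs) * q ^ sum_list xs)) has_sum Re (G N)) (partitions_upto N)"
      by (simp add: norm_mult norm_power flip: of_real_power)
    hence "(\<Sum>xs\<in>F. norm (of_nat (weight r xs) * q ^ sum_list xs)) \<le> Re (G N)"
      by (rule finite_sum_le_has_sum) (use F FN in auto)
    also have "\<dots> \<le> K" using complex_Re_le_cmod[of "G N"] K[of N] by linarith
    finally show "(\<Sum>xs\<in>F. norm (of_nat (weight r xs) * q ^ sum_list xs)) \<le> K" .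
  qed
qed

theorem theorem1p10:
  fixes r :: nat and q :: complex
  assumes "r \<ge> 1" and "norm q < 1"
  shows "(\<lambda>n. (\<Sum>xs\<in>partitions n.
             of_nat (largest_part xs) - of_nat (maex xs r) + of_nat (Omega r xs)) * q ^ n)
         sums
         (qpoch_inf (q ^ (r + 1)) (q ^ (r + 1)) / qpoch_inf q q
          + 1 / qpoch_inf q q
            * (\<Sum>n. q ^ Suc n * qpoch (q ^ (r + 1)) (q ^ (r + 1)) (Suc n) / (1 - q ^ Suc n)))"
proof -
  define A where "A = (\<Union>N. partitions_upto N)"
  define f where "f xs = of_nat (weight r xs) * q ^ sum_list xs" for xs
  have "f summable_on A" unfolding f_def A_def by (rule summable_weight[OF assms])
  then obtain S where S: "(f has_sum S) A" by (auto simp: summable_on_def)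
  have upto: "{xs \<in> A. length xs \<le> N} = partitions_upto N" for N
    by (auto simp: A_def partitions_upto_def)
  \<comment> \<open>Exhausting all partitions by the number of parts evaluates the total sum \<open>S\<close> ...\<close>
  have "(\<lambda>N. infsum f {xs \<in> A. length xs \<le> N}) \<longlonglongrightarrow> S" by (rule infsum_upto_tendsto[OF S])
  hence "(\<lambda>N. qpoch (q ^ Suc r) (q ^ Suc r) N / qpoch q q N + 1 / qpoch q q N *
      (\<Sum>n<N. q ^ Suc n * qpoch (q ^ Suc r) (q ^ Suc r) (Suc n) / (1 - q ^ Suc n))) \<longlonglongrightarrow> S"
    unfolding upto f_def infsumI[OF gf_weight[OF assms]] .
  from LIMSEQ_unique[OF this gf_weight_tendsto[OF assms(2)]]
  have S_eq: "S = qpoch_inf (q ^ (r + 1)) (q ^ (r + 1)) / qpoch_inf q q + 1 / qpoch_inf q q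
      * (\<Sum>n. q ^ Suc n * qpoch (q ^ (r + 1)) (q ^ (r + 1)) (Suc n) / (1 - q ^ Suc n))"
    by simp
  \<comment> \<open>... and grouping them by size exhibits the same \<open>S\<close> as the sum of the power series.\<close>
  have size: "{xs \<in> A. sum_list xs = n} = partitions n" for n
    by (auto simp: A_def partitions_upto_def partitions_def)
  have "infsum f (partitions n) = (\<Sum>xs\<in>partitions n.
      of_nat (largest_part xs) - of_nat (maex xs r) + of_nat (Omega r xs)) * q ^ n" for n
  proof -
    have "f xs = (of_nat (largest_part xs) - of_nat (maex xs r) + of_nat (Omega r xs)) * q ^ n"
      if "xs \<in> partitions n" for xs
      using that maex_le_largest_part[of xs r]
      by (simp add: f_def weight_def partitions_def)
    thus ?thesis by (simp add: infsum_finite[OF finite_partitions] sum_distrib_right)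
  qed
  with has_sum_imp_sums_fibres[OF S, of sum_list] show ?thesis
    unfolding size S_eq by simp
qed

end
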